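(* The following monotonicity properties hold. (a) Class monotonicity: the parameters $\mathrm{VCD}$, $\mathrm{RTD}$, $\min\{\mathrm{VCD},\mathrm{RTD}\}$, $\mathrm{STD}_{min}$, $\mathrm{AMN}$, $\mathrm{GMN}'$, $\mathrm{GMN}$ and $\mathrm{SMN}$ are class monotonic, whereas $\mathrm{AMN}'$ and $\mathrm{SMN}'$ are not class monotonic. (b) Domain monotonicity: the parameters $\mathrm{RTD}$, $\mathrm{STD}_{min}$, $\mathrm{AMN}$, $\mathrm{AMN}'$, $\mathrm{GMN}'$, $\mathrm{GMN}$, $\mathrm{SMN}$ and $\mathrm{SMN}'$ are domain monotonic, whereas $\mathrm{VCD}$ and $\min\{\mathrm{VCD},\mathrm{RTD}\}$ are not domain monotonic. ($\mathrm{VCD}$ is domain monotonic in the other direction: for each domain extension $(C',X')$ of $(C,X)$, $\mathrm{VCD}(C)\le\mathrm{VCD}(C')$.)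
   Context: Let $X$ be a finite set. A concept class $C$ over the domain $X=\mathrm{dom}(C)$ is a nonempty family of functions $c:X\to\{0,1\}$ (called concepts); we write $(C,X)$ to make the domain explicit. A labeled sample of size $m\ge 0$ is a set $S=\{(x_1,b_1),\ldots,(x_m,b_m)\}\subseteq X\times\{0,1\}$ with $x_1,\ldots,x_m$ distinct; $|S|=m$ (the empty sample is allowed). A concept $c$ is consistent with $S$ if $c(x_i)=b_i$ for all $i$. $S$ is $C$-realizable if some $c\in C$ is consistent with $S$. Extensions: $(C',X)$ is a class extension of $(C,X)$ if $C\subsetneq C'$ (same domain $X$). $(C',X')$ is a domain extension of $(C,X)$ if $X\subsetneq X'$, $C=\{c_{|X}:c\in C'\}$ and $|C|=|C'|$. A parameter $Y$ is class monotonic if $Y(C)\le Y(C')$ for each class extension $(C',X)$ of $(C,X)$; it is domain monotonic if $Y(C')\le Y(C)$ for each domain extension $(C',X')$ of $(C,X)$. A $C$-saturating matching is a map $M$ assigning to each $c\in C$ a labeled sample $M(c)$ with which $c$ is consistent, such that $M(c)\ne M(c')$ whenever $c\neq c'$ in $C$. Its cost is $\max_{c\in C}|M(c)|$. It has the antichain property if $M(c)\not\subseteq M(c')$ for all distinct $c,c'\in C$. A $C$-saturating matching $M'$ is a direct improvement of a $C$-saturating matching $M$ if $M'$ differs from $M$ only on a single concept $c$ and $|M'(c)|<|M(c)|$. $M$ is greedy if it admits no direct improvement. Parameters: - $\mathrm{SMN}(C)$: the smallest cost of a $C$-saturating matching. - $\mathrm{SMN}'(C)$: the smallest $d$ such that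 the number of $C$-realizable samples of size at most $d$ is at least $|C|$. - $\mathrm{AMN}(C)$: the smallest cost of a $C$-saturating matching having the antichain property. - $\mathrm{AMN}'(C)$: the smallest $d$ such that the set of $C$-realizable samples of size at most $d$ contains an antichain (with respect to inclusion) of size $|C|$. - $\mathrm{GMN}(C)$: the largest cost of a greedy $C$-saturating matching. - $\mathrm{GMN}'(C)$: the smallest $d$ such that $\sum_{i=0}^{d}\binom{|X|}{i}\ge|C|$. - $\mathrm{VCD}(C)$: the VC-dimension, i.e. the size of the largest set $\{x_1,\ldots,x_r\}\subseteq X$ such that for every choice of $b_1,\ldots,b_r\in\{0,1\}$ the sample $\{(x_1,b_1),\ldots,(x_r,b_r)\}$ is $C$-realizable. - $\mathrm{RTD}(C)$: the recursive teaching dimension, $\mathrm{RTD}(C)=\max_{\emptyset\ne C'\subseteq C}\min_{c\in C'}\mathrm{TD}(c,C')$, where $\mathrm{TD}(c,C')$ is the smallest size of a labeled sample $S$ such that $c$ is the only concept in $C'$ consistent with $S$. - $\mathrm{STD}_{min}(C)$: a sequence $\mathcal{M}=(M_k)_{k\ge 0}$ of $C$-saturating matchings is a subset teaching sequence for $C$ if $M_0(c)=\{(x,c(x)):x\in X\}$ for all $c\in C$; $M_{k+1}(c)\subseteq M_k(c)$ for all $k\ge0$, $c\in C$; and $M_{k+1}(c)\not\subseteq M_k(c')$ for all $k\ge 0$ and all distinct $c,c'\in C$. Let $k^*(\mathcal{M})=\min\{k:\forall k'\ge k,\ \forall c\in C,\ M_{k'}(c)=M_k(c)\}$ and let $\mathrm{cost}(\mathcal{M})$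 be the cost of $M_{k^*(\mathcal{M})}$. Then $\mathrm{STD}_{min}(C)$ is the minimum of $\mathrm{cost}(\mathcal{M})$ over all subset teaching sequences $\mathcal{M}$ for $C$. $\min\{\mathrm{VCD},\mathrm{RTD}\}$ denotes the parameter $C\mapsto\min\{\mathrm{VCD}(C),\mathrm{RTD}(C)\}$. *)

theory Defs
  imports Complex_Main "HOL-Library.FuncSet"
begin

text \<open>
  The labels 0 and 1 are rendered as \<^const>\<open>False\<close> and \<^const>\<open>True\<close>.  A function from the domain
  \<open>X\<close> to the labels is an extensional function (it is \<^const>\<open>undefined\<close> outside \<open>X\<close>), so that two
  concepts are equal iff they agree on \<open>X\<close>.
\<close>

definition concept_class :: "('a \<Rightarrow> bool) set \<Rightarrow> 'a set \<Rightarrow> bool" where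
  "concept_class C X \<longleftrightarrow> finite X \<and> C \<noteq> {} \<and> C \<subseteq> (X \<rightarrow>\<^sub>E UNIV)"

definition labeled_sample :: "'a set \<Rightarrow> ('a \<times> bool) set \<Rightarrow> bool" where
  "labeled_sample X S \<longleftrightarrow> S \<subseteq> X \<times> UNIV \<and> inj_on fst S"

definition consistent :: "('a \<Rightarrow> bool) \<Rightarrow> ('a \<times> bool) set \<Rightarrow> bool" where
  "consistent c S \<longleftrightarrow> (\<forall>(x, b)\<in>S. c x = b)"

definition realizable :: "('a \<Rightarrow> bool) set \<Rightarrow> 'a set \<Rightarrow> ('a \<times> bool) set \<Rightarrow> bool" where
  "realizable C X S \<longleftrightarrow> labeled_sample X S \<and> (\<exists>c\<in>C. consistent c S)"

text \<open>
  A parameter takes the class together with its domain, since the set \<open>C\<close> alone does not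
  determine \<open>X\<close>.  Its values are only meaningful when \<^term>\<open>concept_class C X\<close> holds.
\<close>

type_synonym 'a parameter = "('a \<Rightarrow> bool) set \<Rightarrow> 'a set \<Rightarrow> nat"

definition class_extension :: "('a \<Rightarrow> bool) set \<Rightarrow> ('a \<Rightarrow> bool) set \<Rightarrow> 'a set \<Rightarrow> bool" where
  "class_extension C' C X \<longleftrightarrow> concept_class C X \<and> concept_class C' X \<and> C \<subset> C'"

definition domain_extension ::
    "('a \<Rightarrow> bool) set \<Rightarrow> 'a set \<Rightarrow> ('a \<Rightarrow> bool) set \<Rightarrow> 'a set \<Rightarrow> bool" where
  "domain_extension C' X' C X \<longleftrightarrow>
     concept_class C X \<and> concept_class C' X' \<and> X \<subset> X' \<and>
     C = (\<lambda>c. restrict c X) ` C' \<and> card C = card C'"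

text \<open>
  These predicates range over domains inside one type \<open>'a\<close>.  Monotonicity is to be stated for every
  \<open>'a\<close>.  Its failure asserts the existence of a counterexample on some finite domain, which a small
  finite type may not contain; it is to be stated for \<^typ>\<open>nat\<close>, into which every finite domain
  embeds.
\<close>

definition class_monotonic :: "'a parameter \<Rightarrow> bool" where
  "class_monotonic Y \<longleftrightarrow> (\<forall>C C' X. class_extension C' C X \<longrightarrow> Y C X \<le> Y C' X)"

definition domain_monotonic :: "'a parameter \<Rightarrow> bool" where
  "domain_monotonic Y \<longleftrightarrow> (\<forall>C X C' X'. domain_extension C' X' C X \<longrightarrow> Y C' X' \<le> Y C X)"

text \<open>Matchings are HOL functions; their values outside \<open>C\<close> are never inspected.\<close>

type_synonym 'a matching = "('a \<Rightarrow> bool) \<Rightarrow> ('a \<times> bool) set"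

definition saturating_matching :: "('a \<Rightarrow> bool) set \<Rightarrow> 'a set \<Rightarrow> 'a matching \<Rightarrow> bool" where
  "saturating_matching C X M \<longleftrightarrow>
     (\<forall>c\<in>C. labeled_sample X (M c) \<and> consistent c (M c)) \<and>
     (\<forall>c\<in>C. \<forall>c'\<in>C. c \<noteq> c' \<longrightarrow> M c \<noteq> M c')"

definition matching_cost :: "('a \<Rightarrow> bool) set \<Rightarrow> 'a matching \<Rightarrow> nat" where
  "matching_cost C M = Max ((\<lambda>c. card (M c)) ` C)"

definition antichain_property :: "('a \<Rightarrow> bool) set \<Rightarrow> 'a matching \<Rightarrow> bool" where
  "antichain_property C M \<longleftrightarrow> (\<forall>c\<in>C. \<forall>c'\<in>C. c \<noteq> c' \<longrightarrow> \<not> M c \<subseteq> M c')"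

definition direct_improvement ::
    "('a \<Rightarrow> bool) set \<Rightarrow> 'a set \<Rightarrow> 'a matching \<Rightarrow> 'a matching \<Rightarrow> bool" where
  "direct_improvement C X M' M \<longleftrightarrow>
     saturating_matching C X M \<and> saturating_matching C X M' \<and>
     (\<exists>c\<in>C. (\<forall>c'\<in>C. c' \<noteq> c \<longrightarrow> M' c' = M c') \<and> card (M' c) < card (M c))"

definition greedy_matching :: "('a \<Rightarrow> bool) set \<Rightarrow> 'a set \<Rightarrow> 'a matching \<Rightarrow> bool" where
  "greedy_matching C X M \<longleftrightarrow>
     saturating_matching C X M \<and> \<not> (\<exists>M'. direct_improvement C X M' M)"

definition SMN :: "'a parameter" where
  "SMN C X = (LEAST d. \<exists>M. saturating_matching C X M \<and> matching_cost C M = d)"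

definition SMN' :: "'a parameter" where
  "SMN' C X = (LEAST d. card C \<le> card {S. realizable C X S \<and> card S \<le> d})"

definition AMN :: "'a parameter" where
  "AMN C X = (LEAST d. \<exists>M. saturating_matching C X M \<and> antichain_property C M \<and>
     matching_cost C M = d)"

definition antichain :: "'b set set \<Rightarrow> bool" where
  "antichain \<A> \<longleftrightarrow> (\<forall>S\<in>\<A>. \<forall>T\<in>\<A>. S \<noteq> T \<longrightarrow> \<not> S \<subseteq> T)"

definition AMN' :: "'a parameter" where
  "AMN' C X = (LEAST d. \<exists>\<A> \<subseteq> {S. realizable C X S \<and> card S \<le> d}.
     antichain \<A> \<and> card \<A> = card C)"

text \<open>Every cost is at most \<^term>\<open>card X\<close>, so the following set of costs is finite.\<close>

definition GMN :: "'a parameter" where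
  "GMN C X = Max {matching_cost C M | M. greedy_matching C X M}"

definition GMN' :: "'a parameter" where
  "GMN' C X = (LEAST d. card C \<le> (\<Sum>i=0..d. card X choose i))"

definition shattered :: "('a \<Rightarrow> bool) set \<Rightarrow> 'a set \<Rightarrow> 'a set \<Rightarrow> bool" where
  "shattered C X A \<longleftrightarrow> A \<subseteq> X \<and> (\<forall>b :: 'a \<Rightarrow> bool. realizable C X ((\<lambda>x. (x, b x)) ` A))"

definition VCD :: "'a parameter" where
  "VCD C X = Max {card A | A. shattered C X A}"

definition TD :: "('a \<Rightarrow> bool) \<Rightarrow> ('a \<Rightarrow> bool) set \<Rightarrow> 'a set \<Rightarrow> nat" where
  "TD c C X = (LEAST d. \<exists>S. labeled_sample X S \<and> card S = d \<and> {c'\<in>C. consistent c' S} = {c})"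

definition RTD :: "'a parameter" where
  "RTD C X = Max ((\<lambda>C'. Min ((\<lambda>c. TD c C' X) ` C')) ` {C'. C' \<noteq> {} \<and> C' \<subseteq> C})"

definition min_VCD_RTD :: "'a parameter" where
  "min_VCD_RTD C X = min (VCD C X) (RTD C X)"

definition subset_teaching_sequence ::
    "('a \<Rightarrow> bool) set \<Rightarrow> 'a set \<Rightarrow> (nat \<Rightarrow> 'a matching) \<Rightarrow> bool" where
  "subset_teaching_sequence C X M \<longleftrightarrow>
     (\<forall>k. saturating_matching C X (M k)) \<and>
     (\<forall>c\<in>C. M 0 c = (\<lambda>x. (x, c x)) ` X) \<and>
     (\<forall>k. \<forall>c\<in>C. M (Suc k) c \<subseteq> M k c) \<and>
     (\<forall>k. \<forall>c\<in>C. \<forall>c'\<in>C. c \<noteq> c' \<longrightarrow> \<not> M (Suc k) c \<subseteq> M k c')"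

definition stabilization_index :: "('a \<Rightarrow> bool) set \<Rightarrow> (nat \<Rightarrow> 'a matching) \<Rightarrow> nat" where
  "stabilization_index C M = (LEAST k. \<forall>k'\<ge>k. \<forall>c\<in>C. M k' c = M k c)"

definition sequence_cost :: "('a \<Rightarrow> bool) set \<Rightarrow> (nat \<Rightarrow> 'a matching) \<Rightarrow> nat" where
  "sequence_cost C M = matching_cost C (M (stabilization_index C M))"

definition STD_min :: "'a parameter" where
  "STD_min C X = (LEAST d. \<exists>M. subset_teaching_sequence C X M \<and> sequence_cost C M = d)"

end

theory Submission
  imports Defs
begin

text \<open>
  A labeled sample consistent with \<open>c\<close> is a subset of the full sample of \<open>c\<close>.  Matchings restrict to
  subclasses and, along a domain extension, pull back through the restriction bijection; this
  transports everything except greediness.  A greedy matching is transported by fixing the samples that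
  survive and minimising the total size of the others: the fixed samples remain unimprovable because
  the smaller samples that block them are fixed too.
\<close>

section \<open>Samples\<close>

text \<open>\<open>SMN\<close>, \<open>AMN\<close> and \<open>STD_min\<close> are minima, so a
  witness on the side with the larger value is turned into one for the other side.
  \<open>GMN\<close> is a maximum, so its witness travels the opposite way: from the smaller class
  to the larger one, and from the extended domain back to \<open>X\<close>. Restricting or pulling
  back a matching goes in the wrong direction there.

  \<open>SMN'\<close> and \<open>AMN'\<close> count realizable samples only. One more concept raises
  \<open>card C\<close> by one but may make many samples realizable. Take a cube on k of n points
  with the label frozen to \<open>False\<close> on the others: 1 + n + k samples of size at most 1
  are realizable. The constant concept \<open>True\<close> raises this number to 1 + 2n. A
  counterexample thus needs 1 + n + k < 2^k and 2^k + 1 \<le> 2n; the smallest solution is k = 4, n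
  = 9.

  As \<open>RTD\<close> cannot grow under a domain extension, the minimum of \<open>VCD\<close> and
  \<open>RTD\<close> can grow only if \<open>VCD\<close> is smaller than \<open>RTD\<close> to begin
  with. This is what calls for Warmuth's class; its extension refutes domain monotonicity of
  \<open>VCD\<close> at the same time.\<close>

definition full_sample :: "'a set \<Rightarrow> ('a \<Rightarrow> bool) \<Rightarrow> ('a \<times> bool) set" where
  "full_sample X c = (\<lambda>x. (x, c x)) ` X"

lemma sample_iff: "labeled_sample X S \<and> consistent c S \<longleftrightarrow> S \<subseteq> full_sample X c"
proof
  assume *: "labeled_sample X S \<and> consistent c S"
  show "S \<subseteq> full_sample X c"
  proof clarify
    fix x b assume "(x, b) \<in> S"
    with * have "x \<in> X" "c x = b"
      by (auto simp: labeled_sample_def consistent_def)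
    then show "(x, b) \<in> full_sample X c"
      by (auto simp: full_sample_def)
  qed
next
  assume S: "S \<subseteq> full_sample X c"
  have "inj_on fst (full_sample X c)"
    by (auto simp: full_sample_def inj_on_def)
  with S have "inj_on fst S"
    by (rule inj_on_subset[rotated])
  with S show "labeled_sample X S \<and> consistent c S"
    by (auto simp: labeled_sample_def consistent_def full_sample_def)
qed

lemma realizable_iff: "realizable C X S \<longleftrightarrow> (\<exists>c\<in>C. S \<subseteq> full_sample X c)"
  by (metis realizable_def sample_iff)

lemma saturating_iff:
  "saturating_matching C X M \<longleftrightarrow> (\<forall>c\<in>C. M c \<subseteq> full_sample X c) \<and> inj_on M C"
  by (auto simp: saturating_matching_def sample_iff inj_on_def)

lemma finite_full_sample [simp]: "finite X \<Longrightarrow> finite (full_sample X c)"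
  by (simp add: full_sample_def)

lemma card_full_sample [simp]: "card (full_sample X c) = card X"
  by (auto simp: full_sample_def inj_on_def intro: card_image)

lemma full_sample_subset_iff: "full_sample X c \<subseteq> full_sample X c' \<longleftrightarrow> (\<forall>x\<in>X. c x = c' x)"
  by (auto simp: full_sample_def)

lemma full_sample_subset_imp_eq:
  assumes "c \<in> X \<rightarrow>\<^sub>E UNIV" "c' \<in> X \<rightarrow>\<^sub>E UNIV" "full_sample X c \<subseteq> full_sample X c'"
  shows "c = c'"
  using assms by (intro PiE_ext[of c X _ c']) (auto simp: full_sample_subset_iff)

lemma card_le_full_sample:
  assumes "finite X" "S \<subseteq> full_sample X c"
  shows "finite S" "card S \<le> card X"
  using assms finite_subset[OF assms(2)] card_mono[of "full_sample X c" S] by auto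

lemma full_sample_restrict [simp]: "full_sample X (restrict c X) = full_sample X c"
  by (auto simp: full_sample_def)

lemma full_sample_mono: "X \<subseteq> X' \<Longrightarrow> full_sample X c \<subseteq> full_sample X' c"
  by (auto simp: full_sample_def)

lemma concept_class_finite: "concept_class C X \<Longrightarrow> finite C"
  unfolding concept_class_def by (metis finite_PiE finite finite_subset)

lemma concept_class_full_sample_imp_eq:
  assumes "concept_class C X" "c \<in> C" "c' \<in> C" "full_sample X c \<subseteq> full_sample X c'"
  shows "c = c'"
  using assms full_sample_subset_imp_eq[of c X c'] by (auto simp: concept_class_def)

lemma saturating_full_sample: "concept_class C X \<Longrightarrow> saturating_matching C X (full_sample X)"
  unfolding saturating_iff inj_on_def
  using concept_class_full_sample_imp_eq by blast

lemma antichain_property_full_sample: "concept_class C X \<Longrightarrow> antichain_property C (full_sample X)"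
  unfolding antichain_property_def
  using concept_class_full_sample_imp_eq by blast

lemma domain_extensionE:
  assumes "domain_extension C' X' C X"
  obtains "concept_class C X" "concept_class C' X'" "X \<subseteq> X'"
    "C = (\<lambda>c. restrict c X) ` C'" "inj_on (\<lambda>c. restrict c X) C'"
proof
  show "inj_on (\<lambda>c. restrict c X) C'"
    using assms concept_class_finite unfolding domain_extension_def
    by (metis eq_card_imp_inj_on)
qed (use assms in \<open>auto simp: domain_extension_def\<close>)

text \<open>The first hypothesis places the points of \<open>S\<close> in \<open>X\<close>, the
  second makes its labels those of \<open>c'\<close>. Consistency over a larger domain thus descends
  to \<open>X\<close>.\<close>

lemma subset_full_sample_transfer:
  "S \<subseteq> full_sample X c \<Longrightarrow> S \<subseteq> full_sample X' c' \<Longrightarrow> S \<subseteq> full_sample X c'"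
  by (fastforce simp: full_sample_def)

text \<open>The witness \<open>k\<close> keeps the right-hand \<open>LEAST\<close> from being
  unspecified. The slack \<open>e \<le> d\<close> allows a transported matching to become
  cheaper.\<close>

lemma Least_le_Least:
  fixes P Q :: "nat \<Rightarrow> bool"
  assumes "P k" "\<And>d. P d \<Longrightarrow> \<exists>e\<le>d. Q e"
  shows "(LEAST d. Q d) \<le> (LEAST d. P d)"
  using assms by (meson LeastI Least_le order_trans)

section \<open>Matchings\<close>

lemma matching_cost_mono:
  assumes "finite C'" "C \<noteq> {}" "C \<subseteq> C'"
  shows "matching_cost C M \<le> matching_cost C' M"
  using assms unfolding matching_cost_def by (intro Max_mono) auto

lemma card_le_matching_cost: "finite C \<Longrightarrow> c \<in> C \<Longrightarrow> card (M c) \<le> matching_cost C M"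
  unfolding matching_cost_def by simp

lemma matching_cost_le:
  assumes "concept_class C X" "\<And>c. c \<in> C \<Longrightarrow> card (M c) \<le> d"
  shows "matching_cost C M \<le> d"
  using assms concept_class_finite[OF assms(1)]
  by (auto simp: matching_cost_def concept_class_def)

lemma matching_cost_le_card:
  assumes "concept_class C X" "saturating_matching C X M"
  shows "matching_cost C M \<le> card X"
proof (rule matching_cost_le[OF assms(1)])
  fix c assume "c \<in> C"
  then show "card (M c) \<le> card X"
    using assms card_le_full_sample(2)[of X "M c" c] by (simp add: saturating_iff concept_class_def)
qed

lemma matching_cost_image:
  "matching_cost (r ` C) M = matching_cost C (\<lambda>c. M (r c))"
  by (simp add: matching_cost_def image_image)

lemma saturating_subset:
  "saturating_matching C' X M \<Longrightarrow> C \<subseteq> C' \<Longrightarrow> saturating_matching C X M"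
  by (meson saturating_iff inj_on_subset subsetD)

lemma saturating_domain_extension:
  assumes "domain_extension C' X' C X" "saturating_matching C X M"
  shows "saturating_matching C' X' (\<lambda>c. M (restrict c X))"
proof -
  from assms(1) have "X \<subseteq> X'" and C: "C = (\<lambda>c. restrict c X) ` C'"
    and inj: "inj_on (\<lambda>c. restrict c X) C'"
    by (auto elim: domain_extensionE)
  have "M (restrict c X) \<subseteq> full_sample X' c" if "c \<in> C'" for c
    using that assms(2) full_sample_mono[OF \<open>X \<subseteq> X'\<close>, of c] C
    by (force simp: saturating_iff)
  moreover have "inj_on (\<lambda>c. M (restrict c X)) C'"
    using comp_inj_on[OF inj, of M] assms(2) C by (simp add: saturating_iff o_def)
  ultimately show ?thesis
    by (simp add: saturating_iff)
qed

lemma SMN_class_monotonic: "class_monotonic SMN"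
  unfolding class_monotonic_def SMN_def
proof (intro allI impI, rule Least_le_Least)
  fix C C' :: "('a \<Rightarrow> bool) set" and X
  assume ext: "class_extension C' C X"
  show "\<exists>M. saturating_matching C' X M \<and> matching_cost C' M = matching_cost C' (full_sample X)"
    using ext saturating_full_sample by (auto simp: class_extension_def)
  fix d assume "\<exists>M. saturating_matching C' X M \<and> matching_cost C' M = d"
  then obtain M where "saturating_matching C' X M" "matching_cost C' M = d" by blast
  with ext show "\<exists>e\<le>d. \<exists>M. saturating_matching C X M \<and> matching_cost C M = e"
    using matching_cost_mono[of C' C M] concept_class_finite[of C' X] saturating_subset[of C' X M C]
    by (intro exI[of _ "matching_cost C M"] conjI exI[of _ M])
      (auto simp: class_extension_def concept_class_def)
qed

lemma AMN_class_monotonic: "class_monotonic AMN"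
  unfolding class_monotonic_def AMN_def
proof (intro allI impI, rule Least_le_Least)
  fix C C' :: "('a \<Rightarrow> bool) set" and X
  assume ext: "class_extension C' C X"
  show "\<exists>M. saturating_matching C' X M \<and> antichain_property C' M \<and>
      matching_cost C' M = matching_cost C' (full_sample X)"
    using ext saturating_full_sample antichain_property_full_sample
    unfolding class_extension_def by blast
  fix d
  assume "\<exists>M. saturating_matching C' X M \<and> antichain_property C' M \<and> matching_cost C' M = d"
  then obtain M where "saturating_matching C' X M" "antichain_property C' M"
    "matching_cost C' M = d" by blast
  moreover from this ext have "antichain_property C M"
    by (auto simp: class_extension_def antichain_property_def)
  ultimately show "\<exists>e\<le>d. \<exists>M. saturating_matching C X M \<and> antichain_property C M \<and>
      matching_cost C M = e"
    using ext matching_cost_mono[of C' C M] concept_class_finite[of C' X] saturating_subset[of C' X M C]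
    by (intro exI[of _ "matching_cost C M"] conjI exI[of _ M])
      (auto simp: class_extension_def concept_class_def)
qed

lemma SMN_domain_monotonic: "domain_monotonic SMN"
  unfolding domain_monotonic_def SMN_def
proof (intro allI impI, rule Least_le_Least)
  fix C C' :: "('a \<Rightarrow> bool) set" and X X'
  assume ext: "domain_extension C' X' C X"
  show "\<exists>M. saturating_matching C X M \<and> matching_cost C M = matching_cost C (full_sample X)"
    using ext saturating_full_sample by (auto simp: domain_extension_def)
  fix d assume "\<exists>M. saturating_matching C X M \<and> matching_cost C M = d"
  then obtain M where "saturating_matching C X M" "matching_cost C M = d" by blast
  with ext show "\<exists>e\<le>d. \<exists>M. saturating_matching C' X' M \<and> matching_cost C' M = e"
    using saturating_domain_extension[OF ext, of M]
    by (intro exI[of _ d] conjI exI[of _ "\<lambda>c. M (restrict c X)"])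
      (auto simp: domain_extension_def matching_cost_image)
qed

lemma AMN_domain_monotonic: "domain_monotonic AMN"
  unfolding domain_monotonic_def AMN_def
proof (intro allI impI, rule Least_le_Least)
  fix C C' :: "('a \<Rightarrow> bool) set" and X X'
  assume ext: "domain_extension C' X' C X"
  show "\<exists>M. saturating_matching C X M \<and> antichain_property C M \<and>
      matching_cost C M = matching_cost C (full_sample X)"
    using ext saturating_full_sample antichain_property_full_sample
    unfolding domain_extension_def by blast
  fix d assume "\<exists>M. saturating_matching C X M \<and> antichain_property C M \<and> matching_cost C M = d"
  then obtain M where M: "saturating_matching C X M" "antichain_property C M"
    "matching_cost C M = d" by blast
  have "antichain_property C' (\<lambda>c. M (restrict c X))"
    using M(2) ext unfolding antichain_property_def
    by (elim domain_extensionE) (metis imageI inj_onD)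
  with ext M show "\<exists>e\<le>d. \<exists>M. saturating_matching C' X' M \<and> antichain_property C' M \<and>
      matching_cost C' M = e"
    using saturating_domain_extension[OF ext, of M]
    by (intro exI[of _ d] conjI exI[of _ "\<lambda>c. M (restrict c X)"])
      (auto simp: domain_extension_def matching_cost_image)
qed

section \<open>Counting samples\<close>

lemma realizable_full_sample: "c \<in> C \<Longrightarrow> realizable C X (full_sample X c)"
  by (auto simp: realizable_iff)

lemma inj_on_full_sample: "concept_class C X \<Longrightarrow> inj_on (full_sample X) C"
  using saturating_full_sample saturating_iff by blast

lemma finite_realizable:
  assumes "concept_class C X"
  shows "finite {S. realizable C X S}"
proof (rule finite_subset)
  show "{S. realizable C X S} \<subseteq> Pow (X \<times> UNIV)"
    by (auto simp: realizable_def labeled_sample_def)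
qed (use assms in \<open>auto simp: concept_class_def\<close>)

lemma antichain_subset: "antichain \<A> \<Longrightarrow> \<B> \<subseteq> \<A> \<Longrightarrow> antichain \<B>"
  by (auto simp: antichain_def)

lemma AMN'_exists:
  assumes "concept_class C X"
  shows "\<exists>\<A> \<subseteq> {S. realizable C X S \<and> card S \<le> card X}. antichain \<A> \<and> card \<A> = card C"
proof (intro exI[of _ "full_sample X ` C"] conjI)
  show "antichain (full_sample X ` C)"
    using antichain_property_full_sample[OF assms]
    by (auto simp: antichain_def antichain_property_def)
qed (use realizable_full_sample inj_on_full_sample[OF assms] in
    \<open>auto intro: card_image\<close>)

lemma SMN'_exists:
  assumes "concept_class C X"
  shows "card C \<le> card {S. realizable C X S \<and> card S \<le> card X}"
proof -
  obtain \<A> where "\<A> \<subseteq> {S. realizable C X S \<and> card S \<le> card X}" "card \<A> = card C"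
    using AMN'_exists[OF assms] by blast
  then show ?thesis
    using finite_realizable[OF assms] card_mono[of "{S. realizable C X S \<and> card S \<le> card X}" \<A>]
    by simp
qed

text \<open>A concept of \<open>C\<close> realizing \<open>S\<close> is the restriction of some
  concept of \<open>C'\<close>, which has the same labels on \<open>X\<close>. The supply of samples
  therefore only grows while the class keeps its size, which gives domain monotonicity of both
  \<open>SMN'\<close> and \<open>AMN'\<close>.\<close>

lemma realizable_domain_extension:
  assumes "domain_extension C' X' C X" "realizable C X S"
  shows "realizable C' X' S"
  using assms full_sample_mono[of X X']
  by (elim domain_extensionE) (fastforce simp: realizable_iff)

lemma SMN'_domain_monotonic: "domain_monotonic SMN'"
  unfolding domain_monotonic_def SMN'_def
proof (intro allI impI, rule Least_le_Least)
  fix C C' :: "('a \<Rightarrow> bool) set" and X X'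
  assume ext: "domain_extension C' X' C X"
  then show "card C \<le> card {S. realizable C X S \<and> card S \<le> card X}"
    using SMN'_exists by (auto simp: domain_extension_def)
  fix d assume "card C \<le> card {S. realizable C X S \<and> card S \<le> d}"
  moreover have "card {S. realizable C X S \<and> card S \<le> d} \<le>
      card {S. realizable C' X' S \<and> card S \<le> d}"
    using ext finite_realizable[of C' X'] realizable_domain_extension[OF ext]
    by (intro card_mono) (auto simp: domain_extension_def)
  ultimately show "\<exists>e\<le>d. card C' \<le> card {S. realizable C' X' S \<and> card S \<le> e}"
    using ext by (intro exI[of _ d]) (auto simp: domain_extension_def)
qed

lemma AMN'_domain_monotonic: "domain_monotonic AMN'"
  unfolding domain_monotonic_def AMN'_def
proof (intro allI impI, rule Least_le_Least)
  fix C C' :: "('a \<Rightarrow> bool) set" and X X'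
  assume ext: "domain_extension C' X' C X"
  then show "\<exists>\<A> \<subseteq> {S. realizable C X S \<and> card S \<le> card X}. antichain \<A> \<and> card \<A> = card C"
    using AMN'_exists by (auto simp: domain_extension_def)
  have "card C' = card C"
    using ext unfolding domain_extension_def by metis
  fix d assume "\<exists>\<A> \<subseteq> {S. realizable C X S \<and> card S \<le> d}. antichain \<A> \<and> card \<A> = card C"
  then show "\<exists>e\<le>d. \<exists>\<A> \<subseteq> {S. realizable C' X' S \<and> card S \<le> e}. antichain \<A> \<and> card \<A> = card C'"
    unfolding \<open>card C' = card C\<close> using realizable_domain_extension[OF ext] by blast
qed

lemma GMN'_exists:
  assumes "concept_class C X"
  shows "card C \<le> (\<Sum>i=0..card X. card X choose i)"
proof -
  have "card C \<le> card (X \<rightarrow>\<^sub>E (UNIV :: bool set))"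
    using assms by (intro card_mono) (auto simp: concept_class_def intro!: finite_PiE)
  also have "\<dots> = 2 ^ card X"
    using assms by (simp add: concept_class_def card_PiE)
  finally show ?thesis
    by (simp add: choose_row_sum atMost_atLeast0[symmetric])
qed

lemma GMN'_class_monotonic: "class_monotonic GMN'"
  unfolding class_monotonic_def GMN'_def
proof (intro allI impI, rule Least_le_Least)
  fix C C' :: "('a \<Rightarrow> bool) set" and X
  assume ext: "class_extension C' C X"
  then show "card C' \<le> (\<Sum>i=0..card X. card X choose i)"
    using GMN'_exists by (auto simp: class_extension_def)
  have "card C \<le> card C'"
    using ext concept_class_finite[of C' X] by (auto simp: class_extension_def intro: card_mono)
  then show "\<exists>e\<le>d. card C \<le> (\<Sum>i=0..e. card X choose i)"
    if "card C' \<le> (\<Sum>i=0..d. card X choose i)" for d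
    using that by fastforce
qed

lemma GMN'_domain_monotonic: "domain_monotonic GMN'"
  unfolding domain_monotonic_def GMN'_def
proof (intro allI impI, rule Least_le_Least)
  fix C C' :: "('a \<Rightarrow> bool) set" and X X'
  assume ext: "domain_extension C' X' C X"
  then show "card C \<le> (\<Sum>i=0..card X. card X choose i)"
    using GMN'_exists by (auto simp: domain_extension_def)
  have "card X \<le> card X'"
    using ext by (auto simp: domain_extension_def concept_class_def intro: card_mono)
  then have "(\<Sum>i=0..d. card X choose i) \<le> (\<Sum>i=0..d. card X' choose i)" for d
    by (intro sum_mono binomial_right_mono)
  then show "\<exists>e\<le>d. card C' \<le> (\<Sum>i=0..e. card X' choose i)"
    if "card C \<le> (\<Sum>i=0..d. card X choose i)" for d
    using that ext by (metis domain_extension_def order.trans order.refl)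
qed

section \<open>Greedy matchings\<close>

lemma greedy_iff:
  "greedy_matching C X M \<longleftrightarrow> saturating_matching C X M \<and>
    (\<forall>c\<in>C. \<forall>S. S \<subseteq> full_sample X c \<longrightarrow> card S < card (M c) \<longrightarrow> S \<in> M ` C)"
proof (cases "saturating_matching C X M")
  case True
  have "(\<exists>M'. direct_improvement C X M' M) \<longleftrightarrow>
    (\<exists>c\<in>C. \<exists>S. S \<subseteq> full_sample X c \<and> card S < card (M c) \<and> S \<notin> M ` C)"
  proof
    assume "\<exists>M'. direct_improvement C X M' M"
    then obtain M' c where M': "saturating_matching C X M'" and c: "c \<in> C"
      and eq: "\<And>c'. c' \<in> C \<Longrightarrow> c' \<noteq> c \<Longrightarrow> M' c' = M c'" and less: "card (M' c) < card (M c)"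
      by (auto simp: direct_improvement_def)
    have "M' c \<notin> M ` C"
    proof
      assume "M' c \<in> M ` C"
      then obtain e where e: "e \<in> C" "M' c = M e" by blast
      then have "e \<noteq> c" using less by auto
      then show False
        using M' c e eq[of e] by (auto simp: saturating_iff inj_on_def)
    qed
    with M' c less show "\<exists>c\<in>C. \<exists>S. S \<subseteq> full_sample X c \<and> card S < card (M c) \<and> S \<notin> M ` C"
      unfolding saturating_iff by blast
  next
    assume "\<exists>c\<in>C. \<exists>S. S \<subseteq> full_sample X c \<and> card S < card (M c) \<and> S \<notin> M ` C"
    then obtain c S where *: "c \<in> C" "S \<subseteq> full_sample X c" "card S < card (M c)" "S \<notin> M ` C"
      by blast
    then have "saturating_matching C X (M(c := S))"
      using True by (auto simp: saturating_iff inj_on_def)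
    with * True have "direct_improvement C X (M(c := S)) M"
      by (auto simp: direct_improvement_def intro!: bexI[of _ c])
    then show "\<exists>M'. direct_improvement C X M' M" by blast
  qed
  with True show ?thesis
    by (auto simp: greedy_matching_def)
qed (simp add: greedy_matching_def)

text \<open>A matching of least total size among those agreeing with \<open>N\<close> on \<open>K\<close> cannot be improved outside \<open>K\<close>.\<close>

lemma greedy_completion:
  assumes "finite C" "saturating_matching C X N"
  obtains M where "saturating_matching C X M" "\<And>c. c \<in> C \<Longrightarrow> c \<in> K \<Longrightarrow> M c = N c"
    "\<And>c S. c \<in> C \<Longrightarrow> c \<notin> K \<Longrightarrow> S \<subseteq> full_sample X c \<Longrightarrow> card S < card (M c) \<Longrightarrow> S \<in> M ` C"
proof -
  let ?P = "\<lambda>M. saturating_matching C X M \<and> (\<forall>c\<in>C \<inter> K. M c = N c)"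
  obtain M where M: "?P M" and least: "\<And>M'. ?P M' \<Longrightarrow> (\<Sum>c\<in>C. card (M c)) \<le> (\<Sum>c\<in>C. card (M' c))"
    using ex_has_least_nat[of ?P N "\<lambda>M. \<Sum>c\<in>C. card (M c)"] assms(2) by auto
  have "S \<in> M ` C" if *: "c \<in> C" "c \<notin> K" "S \<subseteq> full_sample X c" "card S < card (M c)" for c S
  proof (rule ccontr)
    assume "S \<notin> M ` C"
    then have "?P (M(c := S))"
      using M * by (auto simp: saturating_iff inj_on_def)
    from least[OF this] have "(\<Sum>e\<in>C. card (M e)) \<le> (\<Sum>e\<in>C. card ((M(c := S)) e))" .
    moreover have "(\<Sum>e\<in>C. card ((M(c := S)) e)) < (\<Sum>e\<in>C. card (M e))"
      using * assms(1) by (intro sum_strict_mono_ex1) auto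
    ultimately show False by simp
  qed
  with M that show ?thesis by blast
qed

lemma finite_greedy_costs:
  assumes "concept_class C X"
  shows "finite {matching_cost C M | M. greedy_matching C X M}"
  using matching_cost_le_card[OF assms]
  by (auto intro!: finite_subset[of _ "{..card X}"] simp: greedy_matching_def)

lemma GMN_attained:
  assumes "concept_class C X"
  obtains M where "greedy_matching C X M" "GMN C X = matching_cost C M"
proof -
  \<comment> \<open>With nothing held fixed, the completion is greedy everywhere. This makes the set
    of costs nonempty, so that its \<open>Max\<close> is one of them.\<close>
  obtain M where "greedy_matching C X M"
    using greedy_completion[OF concept_class_finite[OF assms] saturating_full_sample[OF assms], of "{}"]
    by (metis empty_iff greedy_iff)
  then have "{matching_cost C M | M. greedy_matching C X M} \<noteq> {}" by blast
  from Max_in[OF finite_greedy_costs[OF assms] this] that show ?thesis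
    unfolding GMN_def by blast
qed

lemma matching_cost_le_GMN:
  assumes "concept_class C X" "greedy_matching C X M"
  shows "matching_cost C M \<le> GMN C X"
  unfolding GMN_def using assms finite_greedy_costs by (intro Max_ge) auto

lemma GMN_class_monotonic: "class_monotonic GMN"
  unfolding class_monotonic_def
proof (intro allI impI)
  fix C C' :: "('a \<Rightarrow> bool) set" and X
  assume "class_extension C' C X"
  then have C: "concept_class C X" and C': "concept_class C' X" and "C \<subseteq> C'"
    by (auto simp: class_extension_def)
  obtain M where M: "greedy_matching C X M" and GMN: "GMN C X = matching_cost C M"
    using GMN_attained[OF C] .
  \<comment> \<open>The full sample of a new concept lies in no sample consistent with a different
    concept, so it cannot collide with a sample used by \<open>M\<close>.\<close>
  define N where "N = (\<lambda>c. if c \<in> C then M c else full_sample X c)"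
  have "c = c'" if "c \<in> C'" "c' \<in> C'" "c \<notin> C" "N c = N c'" for c c'
  proof -
    have "N c' \<subseteq> full_sample X c'"
      using M by (auto simp: N_def greedy_iff saturating_iff)
    with that show ?thesis
      using concept_class_full_sample_imp_eq[OF C', of c c'] by (simp add: N_def)
  qed
  moreover have "inj_on M C"
    using M by (simp add: greedy_iff saturating_iff)
  ultimately have "inj_on N C'"
    unfolding inj_on_def by (metis N_def)
  then have "saturating_matching C' X N"
    using M by (auto simp: N_def greedy_iff saturating_iff)
  from greedy_completion[OF concept_class_finite[OF C'] this, of C]
  obtain M' where M': "saturating_matching C' X M'" "\<And>c. c \<in> C' \<Longrightarrow> c \<in> C \<Longrightarrow> M' c = N c"
    "\<And>c S. c \<in> C' \<Longrightarrow> c \<notin> C \<Longrightarrow> S \<subseteq> full_sample X c \<Longrightarrow> card S < card (M' c) \<Longrightarrow> S \<in> M' ` C'"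
    by blast
  have eq: "M' c = M c" if "c \<in> C" for c
    using that M'(2) \<open>C \<subseteq> C'\<close> by (auto simp: N_def)
  then have "M ` C \<subseteq> M' ` C'"
    using \<open>C \<subseteq> C'\<close> by force
  then have "S \<in> M' ` C'"
    if "c \<in> C" "S \<subseteq> full_sample X c" "card S < card (M' c)" for c S
    using that M eq unfolding greedy_iff by (metis subsetD)
  with M' have "greedy_matching C' X M'"
    unfolding greedy_iff by blast
  have "matching_cost C M = matching_cost C M'"
    using eq by (simp add: matching_cost_def)
  also have "\<dots> \<le> matching_cost C' M'"
    using C \<open>C \<subseteq> C'\<close> concept_class_finite[OF C']
    by (intro matching_cost_mono) (auto simp: concept_class_def)
  also have "\<dots> \<le> GMN C' X"
    using C' \<open>greedy_matching C' X M'\<close> by (rule matching_cost_le_GMN)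
  finally show "GMN C X \<le> GMN C' X"
    by (simp add: GMN)
qed

text \<open>
  The concepts whose sample in a greedy matching \<open>M'\<close> of the extended class lies over \<open>X\<close> keep it;
  no smaller sample over \<open>X\<close> is available to them, since \<open>M'\<close> uses those too, again for concepts that
  keep their samples.
\<close>

lemma GMN_domain_monotonic: "domain_monotonic GMN"
  unfolding domain_monotonic_def
proof (intro allI impI)
  fix C C' :: "('a \<Rightarrow> bool) set" and X X'
  assume "domain_extension C' X' C X"
  then have C: "concept_class C X" and C': "concept_class C' X'" and "X \<subseteq> X'"
    and img: "C = (\<lambda>c. restrict c X) ` C'" and inj: "inj_on (\<lambda>c. restrict c X) C'"
    by (auto elim: domain_extensionE)
  obtain M' where M': "greedy_matching C' X' M'" and GMN: "GMN C' X' = matching_cost C' M'"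
    using GMN_attained[OF C'] .
  define g where "g = inv_into C' (\<lambda>c. restrict c X)"
  have g: "g c \<in> C'" "restrict (g c) X = c" if "c \<in> C" for c
    using that img inv_into_into[of c "\<lambda>c. restrict c X" C']
      f_inv_into_f[of c "\<lambda>c. restrict c X" C'] by (auto simp: g_def)
  have g_restrict: "g (restrict c X) = c" if "c \<in> C'" for c
    using that inv_into_f_f[OF inj] by (simp add: g_def)
  have sub: "full_sample X c \<subseteq> full_sample X' (g c)" if "c \<in> C" for c
    using full_sample_mono[OF \<open>X \<subseteq> X'\<close>, of "g c"] g(2)[OF that]
    by (metis full_sample_restrict)
  define K where "K = {c. M' (g c) \<subseteq> full_sample X c}"
  define N where "N = (\<lambda>c. if c \<in> K then M' (g c) else full_sample X c)"
  have N_sub: "N c \<subseteq> full_sample X c" for c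
    by (auto simp: N_def K_def)
  have "c = c'" if "c \<in> C" "c' \<in> C" "c \<notin> K" "N c = N c'" for c c'
    using that N_sub[of c'] concept_class_full_sample_imp_eq[OF C, of c c'] by (simp add: N_def)
  moreover have "c = c'" if "c \<in> C" "c' \<in> C" "M' (g c) = M' (g c')" for c c'
    using that M' g by (metis greedy_iff saturating_iff inj_onD)
  ultimately have "inj_on N C"
    unfolding inj_on_def by (metis N_def)
  then have "saturating_matching C X N"
    using N_sub by (simp add: saturating_iff)
  from greedy_completion[OF concept_class_finite[OF C] this, of K]
  obtain M where M: "saturating_matching C X M" "\<And>c. c \<in> C \<Longrightarrow> c \<in> K \<Longrightarrow> M c = N c"
    "\<And>c S. c \<in> C \<Longrightarrow> c \<notin> K \<Longrightarrow> S \<subseteq> full_sample X c \<Longrightarrow> card S < card (M c) \<Longrightarrow> S \<in> M ` C"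
    by blast
  have eq: "M c = M' (g c)" if "c \<in> C" "c \<in> K" for c
    using that M(2) by (simp add: N_def)
  have kept: "\<exists>k\<in>C \<inter> K. S = M k"
    if c: "c \<in> C" and S: "S \<subseteq> full_sample X c" and less: "card S < card (M' (g c))" for c S
  proof -
    have "S \<in> M' ` C'"
      using M' g(1)[OF c] sub[OF c] S less unfolding greedy_iff by blast
    then obtain e where e: "e \<in> C'" "S = M' e" by blast
    then have "S \<subseteq> full_sample X' e"
      using M' by (auto simp: greedy_iff saturating_iff)
    with S have "S \<subseteq> full_sample X (restrict e X)"
      unfolding full_sample_restrict by (rule subset_full_sample_transfer)
    with e have "restrict e X \<in> K" "restrict e X \<in> C"
      using g_restrict img by (auto simp: K_def)
    with e show ?thesis
      using eq g_restrict by (intro bexI[of _ "restrict e X"]) auto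
  qed
  have "S \<in> M ` C" if "c \<in> C" "c \<in> K" "S \<subseteq> full_sample X c" "card S < card (M c)" for c S
    using that kept[of c S] eq[of c] by auto
  with M have greedy: "greedy_matching C X M"
    unfolding greedy_iff by blast
  \<comment> \<open>If the sample of \<open>?c\<close> under \<open>M\<close> were smaller than that
    of \<open>c'\<close> under \<open>M'\<close>, then by \<open>kept\<close> some \<open>k\<close>
    in \<open>K\<close> would hold it. Injectivity makes \<open>k\<close> equal to
    \<open>?c\<close>, but concepts in \<open>K\<close> have unchanged samples.\<close>
  have "card (M' c') \<le> card (M (restrict c' X))" if "c' \<in> C'" for c'
  proof (rule ccontr)
    let ?c = "restrict c' X"
    assume less: "\<not> ?thesis"
    have c: "?c \<in> C" "M' (g ?c) = M' c'"
      using img that g_restrict by auto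
    moreover have "M ?c \<subseteq> full_sample X ?c"
      using M(1) c(1) unfolding saturating_iff by blast
    ultimately obtain k where "k \<in> C" "k \<in> K" "M ?c = M k"
      using less kept[of ?c "M ?c"] by auto
    then have "?c \<in> K"
      using M(1) c(1) by (auto simp: saturating_iff inj_on_def)
    with c less eq show False by auto
  qed
  moreover have "card (M (restrict c' X)) \<le> matching_cost C M" if "c' \<in> C'" for c'
    using that img concept_class_finite[OF C] by (intro card_le_matching_cost) (metis imageI)+
  ultimately have "matching_cost C' M' \<le> matching_cost C M"
    using C' by (intro matching_cost_le) (auto intro: order_trans)
  also have "\<dots> \<le> GMN C X"
    using C greedy by (rule matching_cost_le_GMN)
  finally show "GMN C' X' \<le> GMN C X"
    by (simp add: GMN)
qed

section \<open>Subset teaching sequences\<close>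

lemma subset_teaching_sequence_antimono:
  assumes "subset_teaching_sequence C X M" "c \<in> C" "k \<le> k'"
  shows "M k' c \<subseteq> M k c"
  using assms(3)
proof (induction rule: dec_induct)
  case (step n)
  then show ?case
    using assms unfolding subset_teaching_sequence_def by blast
qed simp

text \<open>Each concept has a decreasing chain of finite samples, and there are finitely many
  concepts. This makes the \<open>LEAST\<close> in \<open>stabilization_index\<close>
  attained.\<close>

lemma eventually_stable:
  assumes "concept_class C X" "subset_teaching_sequence C X M"
  shows "\<exists>k. \<forall>k'\<ge>k. \<forall>c\<in>C. M k' c = M k c"
proof -
  have "\<forall>\<^sub>F k in sequentially. \<forall>k'\<ge>k. M k' c = M k c" if "c \<in> C" for c
  proof -
    \<comment> \<open>From an index of minimal sample size on, every later sample is a subset with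
      at least as many elements, hence equal.\<close>
    obtain k where k: "\<And>k'. card (M k c) \<le> card (M k' c)"
      using ex_has_least_nat[of "\<lambda>_. True" 0 "\<lambda>k. card (M k c)"] by auto
    have "M k' c = M k c" if "k' \<ge> k" for k'
    proof (rule card_seteq)
      have "M k c \<subseteq> full_sample X c"
        using assms(2) \<open>c \<in> C\<close> by (auto simp: subset_teaching_sequence_def saturating_iff)
      then show "finite (M k c)"
        using assms(1) card_le_full_sample(1) by (auto simp: concept_class_def)
    qed (use k that \<open>c \<in> C\<close> subset_teaching_sequence_antimono[OF assms(2)] in auto)
    then show ?thesis
      unfolding eventually_sequentially by (metis order_trans)
  qed
  then have "\<forall>\<^sub>F k in sequentially. \<forall>c\<in>C. \<forall>k'\<ge>k. M k' c = M k c"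
    using concept_class_finite[OF assms(1)] by (simp add: eventually_ball_finite)
  then show ?thesis
    unfolding eventually_sequentially by blast
qed

text \<open>The stabilization index depends on the class, so two sequences to be compared may stop
  at different stages. The eventual form lets both costs be read off at one common late
  stage.\<close>

lemma sequence_cost_eventually:
  assumes "concept_class C X" "subset_teaching_sequence C X M"
  shows "\<forall>\<^sub>F k in sequentially. sequence_cost C M = matching_cost C (M k)"
proof -
  let ?k = "stabilization_index C M"
  have "\<forall>k'\<ge>?k. \<forall>c\<in>C. M k' c = M ?k c"
    unfolding stabilization_index_def by (rule LeastI_ex) (rule eventually_stable[OF assms])
  then have "(\<lambda>c. card (M ?k c)) ` C = (\<lambda>c. card (M k c)) ` C" if "k \<ge> ?k" for k
    using that by (intro image_cong) (metis order.refl)+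
  then have "sequence_cost C M = matching_cost C (M k)" if "k \<ge> ?k" for k
    using that unfolding sequence_cost_def matching_cost_def by metis
  then show ?thesis
    unfolding eventually_sequentially by blast
qed

lemma subset_teaching_sequence_full_sample:
  assumes "concept_class C X"
  shows "subset_teaching_sequence C X (\<lambda>_. full_sample X)"
  using saturating_full_sample[OF assms] concept_class_full_sample_imp_eq[OF assms]
  by (auto simp: subset_teaching_sequence_def full_sample_def[symmetric])

lemma STD_min_class_monotonic: "class_monotonic STD_min"
  unfolding class_monotonic_def STD_min_def
proof (intro allI impI, rule Least_le_Least)
  fix C C' :: "('a \<Rightarrow> bool) set" and X
  assume "class_extension C' C X"
  then have C: "concept_class C X" and C': "concept_class C' X" and "C \<subseteq> C'"
    by (auto simp: class_extension_def)
  show "\<exists>M. subset_teaching_sequence C' X M \<and>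
      sequence_cost C' M = sequence_cost C' (\<lambda>_. full_sample X)"
    using subset_teaching_sequence_full_sample[OF C'] by blast
  fix d assume "\<exists>M. subset_teaching_sequence C' X M \<and> sequence_cost C' M = d"
  then obtain M where M: "subset_teaching_sequence C' X M" "sequence_cost C' M = d" by blast
  then have M_C: "subset_teaching_sequence C X M"
    using saturating_subset[OF _ \<open>C \<subseteq> C'\<close>] \<open>C \<subseteq> C'\<close>
    unfolding subset_teaching_sequence_def by (metis subsetD)
  have "\<forall>\<^sub>F k in sequentially. sequence_cost C M \<le> sequence_cost C' M"
    using sequence_cost_eventually[OF C M_C] sequence_cost_eventually[OF C' M(1)]
  proof eventually_elim
    case (elim k)
    then show ?case
      using matching_cost_mono[OF concept_class_finite[OF C'] _ \<open>C \<subseteq> C'\<close>] C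
      by (simp add: concept_class_def)
  qed
  with M M_C show "\<exists>e\<le>d. \<exists>M. subset_teaching_sequence C X M \<and> sequence_cost C M = e"
    by auto
qed

text \<open>Stage 0 is prescribed to be the full samples over \<open>X'\<close>, so the pullback can
  start only at stage 1. The critical step is from 0 to 1: a sample over \<open>X\<close> contained
  in \<open>full_sample X' c'\<close> is already contained in \<open>full_sample X c'\<close>, the
  original stage 0, where containment is excluded.\<close>

lemma subset_teaching_sequence_domain_extension:
  assumes ext: "domain_extension C' X' C X" and M: "subset_teaching_sequence C X M"
  shows "subset_teaching_sequence C' X'
    (\<lambda>k c. if k = 0 then full_sample X' c else M k (restrict c X))"
    (is "subset_teaching_sequence _ _ ?M'")
proof -
  from ext have C': "concept_class C' X'" and "X \<subseteq> X'"
    and img: "C = (\<lambda>c. restrict c X) ` C'" and inj: "inj_on (\<lambda>c. restrict c X) C'"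
    by (auto elim: domain_extensionE)
  have restrict_in: "restrict c X \<in> C" if "c \<in> C'" for c
    unfolding img using that by (rule imageI)
  have M0: "M 0 (restrict c X) = full_sample X c" if "c \<in> C'" for c
    using M restrict_in[OF that] full_sample_restrict[of X c]
    by (simp add: subset_teaching_sequence_def full_sample_def)
  have M_sub: "M k (restrict c X) \<subseteq> full_sample X c" if "c \<in> C'" for k c
    using M restrict_in[OF that] full_sample_restrict[of X c]
    unfolding subset_teaching_sequence_def saturating_iff by metis
  have "saturating_matching C' X' (?M' k)" for k
    using saturating_full_sample[OF C'] saturating_domain_extension[OF ext] M
    by (cases k) (auto simp: subset_teaching_sequence_def)
  moreover have "?M' (Suc k) c \<subseteq> ?M' k c" if "c \<in> C'" for k c
  proof (cases k)
    case 0
    then show ?thesis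
      using M_sub[OF that, of 1] full_sample_mono[OF \<open>X \<subseteq> X'\<close>, of c] by auto
  next
    case (Suc n)
    then show ?thesis
      using M restrict_in[OF that] by (simp add: subset_teaching_sequence_def)
  qed
  moreover have "\<not> ?M' (Suc k) c \<subseteq> ?M' k c'" if "c \<in> C'" "c' \<in> C'" "c \<noteq> c'" for k c c'
  proof -
    have "restrict c X \<noteq> restrict c' X"
      using that inj by (auto dest: inj_onD)
    then have *: "\<not> M (Suc k) (restrict c X) \<subseteq> M k (restrict c' X)"
      using M restrict_in that by (simp add: subset_teaching_sequence_def)
    show ?thesis
    proof (cases k)
      case 0
      then show ?thesis
        using * M0[OF that(2)] subset_full_sample_transfer[OF M_sub[OF that(1), of 1], of X' c']
        by auto
    qed (use * in simp)
  qed
  ultimately show ?thesis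
    unfolding subset_teaching_sequence_def by (auto simp: full_sample_def)
qed

lemma STD_min_domain_monotonic: "domain_monotonic STD_min"
  unfolding domain_monotonic_def STD_min_def
proof (intro allI impI, rule Least_le_Least)
  fix C C' :: "('a \<Rightarrow> bool) set" and X X'
  assume ext: "domain_extension C' X' C X"
  then have C: "concept_class C X" and C': "concept_class C' X'"
    and img: "C = (\<lambda>c. restrict c X) ` C'"
    by (auto elim: domain_extensionE)
  show "\<exists>M. subset_teaching_sequence C X M \<and>
      sequence_cost C M = sequence_cost C (\<lambda>_. full_sample X)"
    using subset_teaching_sequence_full_sample[OF C] by blast
  fix d assume "\<exists>M. subset_teaching_sequence C X M \<and> sequence_cost C M = d"
  then obtain M where M: "subset_teaching_sequence C X M" "sequence_cost C M = d" by blast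
  let ?M' = "\<lambda>k c. if k = 0 then full_sample X' c else M k (restrict c X)"
  note M' = subset_teaching_sequence_domain_extension[OF ext M(1)]
  have "\<forall>\<^sub>F k in sequentially. sequence_cost C' ?M' = sequence_cost C M"
    using sequence_cost_eventually[OF C M(1)] sequence_cost_eventually[OF C' M']
      eventually_gt_at_top[of 0]
  proof eventually_elim
    case (elim k)
    \<comment> \<open>Since \<open>k > 0\<close>, the stage lies past the replaced start, and the
      two matchings correspond under restriction.\<close>
    then show ?case
      unfolding img matching_cost_image by (simp add: matching_cost_image)
  qed
  with M M' show "\<exists>e\<le>d. \<exists>M. subset_teaching_sequence C' X' M \<and> sequence_cost C' M = e"
    by (intro exI[of _ d] conjI exI[of _ ?M']) auto
qed

section \<open>VC-dimension\<close>

lemma shattered_iff: "shattered C X A \<longleftrightarrow> A \<subseteq> X \<and> (\<forall>b. \<exists>c\<in>C. \<forall>x\<in>A. c x = b x)"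
proof -
  have "(\<lambda>x. (x, b x)) ` A \<subseteq> full_sample X c \<longleftrightarrow> (\<forall>x\<in>A. c x = b x)" if "A \<subseteq> X" for b c
    using that by (auto simp: full_sample_def)
  then show ?thesis
    by (auto simp: shattered_def realizable_iff)
qed

lemma finite_shattered_cards:
  assumes "concept_class C X"
  shows "finite {card A | A. shattered C X A}"
proof (rule finite_subset)
  show "{card A | A. shattered C X A} \<subseteq> card ` Pow X"
    by (auto simp: shattered_def)
qed (use assms in \<open>auto simp: concept_class_def\<close>)

lemma card_le_VCD:
  assumes "concept_class C X" "shattered C X A"
  shows "card A \<le> VCD C X"
  unfolding VCD_def using assms finite_shattered_cards by (intro Max_ge) auto

lemma VCD_attained:
  assumes "concept_class C X"
  obtains A where "shattered C X A" "VCD C X = card A"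
proof -
  have "shattered C X {}"
    using assms by (auto simp: shattered_iff concept_class_def)
  then have "{card A | A. shattered C X A} \<noteq> {}" by blast
  from Max_in[OF finite_shattered_cards[OF assms] this] that show ?thesis
    unfolding VCD_def by blast
qed

lemma VCD_le_if_shattered_imp:
  assumes "concept_class C X" "concept_class C' X'"
    "\<And>A. shattered C X A \<Longrightarrow> shattered C' X' A"
  shows "VCD C X \<le> VCD C' X'"
  using assms VCD_attained card_le_VCD by metis

lemma VCD_class_monotonic: "class_monotonic VCD"
  unfolding class_monotonic_def
proof (intro allI impI)
  fix C C' :: "('a \<Rightarrow> bool) set" and X
  assume ext: "class_extension C' C X"
  then have "shattered C' X A" if "shattered C X A" for A
    using that unfolding shattered_iff class_extension_def by blast
  with ext show "VCD C X \<le> VCD C' X"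
    unfolding class_extension_def by (blast intro: VCD_le_if_shattered_imp)
qed

lemma VCD_domain_extension_le:
  assumes "domain_extension C' X' C X"
  shows "VCD C X \<le> VCD C' X'"
proof (rule VCD_le_if_shattered_imp)
  fix A assume "shattered C X A"
  then show "shattered C' X' A"
    unfolding shattered_def using realizable_domain_extension[OF assms] assms
    by (auto simp: domain_extension_def)
qed (use assms in \<open>auto simp: domain_extension_def\<close>)

section \<open>Recursive teaching dimension\<close>

text \<open>The full sample of \<open>c\<close> separates it from every other concept, so teaching
  samples exist and the \<open>LEAST\<close> in \<open>TD\<close> is attained.\<close>

lemma TD_attained:
  assumes "concept_class C X" "D \<subseteq> C" "c \<in> D"
  obtains S where "labeled_sample X S" "card S = TD c D X" "{c'\<in>D. consistent c' S} = {c}"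
proof -
  have full: "labeled_sample X (full_sample X c)" "\<And>c'. consistent c' (full_sample X c) \<longleftrightarrow>
      full_sample X c \<subseteq> full_sample X c'"
    by (meson sample_iff order.refl)+
  have "{c'\<in>D. consistent c' (full_sample X c)} = {c}"
    using assms concept_class_full_sample_imp_eq[OF assms(1), of c] by (auto simp: full(2))
  with full(1) have "\<exists>d S. labeled_sample X S \<and> card S = d \<and> {c'\<in>D. consistent c' S} = {c}"
    by blast
  from LeastI_ex[OF this] that show ?thesis
    unfolding TD_def by blast
qed

lemma TD_le:
  assumes "labeled_sample X S" "{c'\<in>D. consistent c' S} = {c}"
  shows "TD c D X \<le> card S"
  unfolding TD_def using assms by (intro Least_le) blast

lemma RTD_ge:
  assumes "concept_class C X" "D \<noteq> {}" "D \<subseteq> C"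
  shows "Min ((\<lambda>c. TD c D X) ` D) \<le> RTD C X"
  unfolding RTD_def using assms concept_class_finite[OF assms(1)] by (intro Max_ge) auto

lemma RTD_le_iff:
  assumes "concept_class C X"
  shows "RTD C X \<le> d \<longleftrightarrow> (\<forall>D. D \<noteq> {} \<longrightarrow> D \<subseteq> C \<longrightarrow> Min ((\<lambda>c. TD c D X) ` D) \<le> d)"
proof -
  have "finite {D. D \<noteq> {} \<and> D \<subseteq> C}"
    using concept_class_finite[OF assms] by (auto intro: finite_subset[of _ "Pow C"])
  moreover have "{D. D \<noteq> {} \<and> D \<subseteq> C} \<noteq> {}"
    using assms by (auto simp: concept_class_def)
  ultimately show ?thesis
    unfolding RTD_def by (subst Max_le_iff) auto
qed

lemma RTD_class_monotonic: "class_monotonic RTD"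
  unfolding class_monotonic_def
proof (intro allI impI)
  fix C C' :: "('a \<Rightarrow> bool) set" and X
  assume "class_extension C' C X"
  then have C: "concept_class C X" and C': "concept_class C' X" and "C \<subseteq> C'"
    by (auto simp: class_extension_def)
  then show "RTD C X \<le> RTD C' X"
    using RTD_ge[OF C'] by (subst RTD_le_iff[OF C]) blast
qed

text \<open>Consistency with a sample over \<open>X\<close> depends on the restriction only, and
  restriction is injective on \<open>C'\<close>. Hence a sample that teaches
  \<open>restrict c X\<close> within the restricted subclass also teaches \<open>c\<close> within
  \<open>D\<close>.\<close>

lemma RTD_domain_monotonic: "domain_monotonic RTD"
  unfolding domain_monotonic_def
proof (intro allI impI)
  fix C C' :: "('a \<Rightarrow> bool) set" and X X'
  assume "domain_extension C' X' C X"
  then have C: "concept_class C X" and C': "concept_class C' X'" and "X \<subseteq> X'"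
    and img: "C = (\<lambda>c. restrict c X) ` C'" and inj: "inj_on (\<lambda>c. restrict c X) C'"
    by (auto elim: domain_extensionE)
  have "Min ((\<lambda>c. TD c D X') ` D) \<le> RTD C X" if D: "D \<noteq> {}" "D \<subseteq> C'" for D
  proof -
    let ?E = "(\<lambda>c. restrict c X) ` D"
    have E: "?E \<noteq> {}" "?E \<subseteq> C"
      using D img by blast+
    have fin: "finite D"
      using D concept_class_finite[OF C'] finite_subset by blast
    have TD: "TD c D X' \<le> TD (restrict c X) ?E X" if "c \<in> D" for c
    proof -
      obtain S where S: "labeled_sample X S" "card S = TD (restrict c X) ?E X"
        "{c'\<in>?E. consistent c' S} = {restrict c X}"
        using TD_attained[OF C E(2), of "restrict c X"] \<open>c \<in> D\<close> by blast
      have restrict: "consistent (restrict c' X) S \<longleftrightarrow> consistent c' S" for c'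
        using sample_iff[of X S "restrict c' X"] sample_iff[of X S c'] S(1) by simp
      have "{c'\<in>D. consistent c' S} = {c}"
      proof (intro equalityI subsetI)
        fix c' assume "c' \<in> {c'\<in>D. consistent c' S}"
        then have "restrict c' X \<in> {c'\<in>?E. consistent c' S}" "c' \<in> C'"
          using restrict D by auto
        then have "restrict c' X = restrict c X" "c' \<in> C'"
          unfolding S(3) by auto
        then show "c' \<in> {c}"
          using inj D \<open>c \<in> D\<close> by (auto dest: inj_onD)
      next
        fix c' assume "c' \<in> {c}"
        moreover have "restrict c X \<in> {c'\<in>?E. consistent c' S}"
          unfolding S(3) by simp
        ultimately show "c' \<in> {c'\<in>D. consistent c' S}"
          using restrict \<open>c \<in> D\<close> by auto
      qed
      moreover have "labeled_sample X' S"
        using S(1) \<open>X \<subseteq> X'\<close> by (auto simp: labeled_sample_def)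
      ultimately show ?thesis
        using TD_le S(2) by metis
    qed
    have "Min ((\<lambda>c. TD c D X') ` D) \<le> Min ((\<lambda>c. TD (restrict c X) ?E X) ` D)"
    proof (rule Min.boundedI)
      fix t assume "t \<in> (\<lambda>c. TD (restrict c X) ?E X) ` D"
      then obtain c where "c \<in> D" "t = TD (restrict c X) ?E X" by blast
      then show "Min ((\<lambda>c. TD c D X') ` D) \<le> t"
        using TD[of c] fin by (meson Min_le finite_imageI imageI order_trans)
    qed (use fin D in auto)
    also have "\<dots> = Min ((\<lambda>c. TD c ?E X) ` ?E)"
      by (simp only: image_image)
    also have "\<dots> \<le> RTD C X"
      using C E by (rule RTD_ge)
    finally show ?thesis .
  qed
  then show "RTD C' X' \<le> RTD C X"
    unfolding RTD_le_iff[OF C'] by blast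
qed

lemma min_VCD_RTD_class_monotonic: "class_monotonic min_VCD_RTD"
  using VCD_class_monotonic RTD_class_monotonic
  unfolding class_monotonic_def min_VCD_RTD_def by (meson min.mono)

section \<open>Counterexamples\<close>

text \<open>
  \<open>cube_class\<close> is a cube over four of nine points, where only 14 samples of size at most 1 are
  realizable for its 16 concepts.  Adding a single concept makes all 19 of them realizable, 18
  of which form an antichain.
\<close>

definition cube_class :: "(nat \<Rightarrow> bool) set" where
  "cube_class = (\<lambda>T. \<lambda>x\<in>{..<9}. x \<in> T) ` Pow {..<4}"

text \<open>The constant concept supplies the label \<open>True\<close> at all five points where the
  cube is frozen to \<open>False\<close>.\<close>

definition cube_class_ext :: "(nat \<Rightarrow> bool) set" where
  "cube_class_ext = insert (\<lambda>x\<in>{..<9}. True) cube_class"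

lemma card_cube_class: "card cube_class = 16"
proof -
  have "inj_on (\<lambda>T. \<lambda>x\<in>{..<9::nat}. x \<in> T) (Pow {..<4})"
  proof (rule inj_onI, rule set_eqI)
    fix T U :: "nat set" and x
    assume "T \<in> Pow {..<4}" "U \<in> Pow {..<4}"
      and eq: "(\<lambda>x\<in>{..<9}. x \<in> T) = (\<lambda>x\<in>{..<9}. x \<in> U)"
    then have "x \<in> {..<9}" if "x \<in> T \<union> U"
      using that by force
    with fun_cong[OF eq, of x] show "x \<in> T \<longleftrightarrow> x \<in> U"
      by (auto split: if_splits)
  qed
  then show ?thesis
    by (simp add: cube_class_def card_image card_Pow)
qed

lemma class_extension_cube_class: "class_extension cube_class_ext cube_class {..<9}"
  and card_cube_class_ext: "card cube_class_ext = 17"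
proof -
  have new: "(\<lambda>x\<in>{..<9::nat}. True) \<notin> cube_class"
  proof
    assume "(\<lambda>x\<in>{..<9::nat}. True) \<in> cube_class"
    then obtain T where "T \<subseteq> {..<4}" "(\<lambda>x\<in>{..<9::nat}. True) = (\<lambda>x\<in>{..<9}. x \<in> T)"
      by (auto simp: cube_class_def)
    from this(1) fun_cong[OF this(2), of 8] show False
      by auto
  qed
  have "concept_class cube_class_ext {..<9}" "concept_class cube_class {..<9}"
    by (auto simp: concept_class_def cube_class_ext_def cube_class_def)
  with new show "class_extension cube_class_ext cube_class {..<9}"
    by (auto simp: class_extension_def cube_class_ext_def)
  show "card cube_class_ext = 17"
    using new card_cube_class by (simp add: cube_class_ext_def cube_class_def)
qed

lemma card_small_realizable_cube_class:
  "card {S. realizable cube_class {..<9} S \<and> card S \<le> 1} \<le> 14"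
proof -
  let ?P = "{..<4::nat} \<times> UNIV \<union> {4..<9} \<times> {False}"
  have "S \<in> insert {} ((\<lambda>z. {z}) ` ?P)"
    if S: "realizable cube_class {..<9} S" "card S \<le> 1" for S
  proof -
    from S(1) obtain T where T: "T \<subseteq> {..<4}" "S \<subseteq> full_sample {..<9} (\<lambda>x\<in>{..<9}. x \<in> T)"
      by (auto simp: realizable_iff cube_class_def)
    then have "S \<subseteq> ?P"
      by (force simp: full_sample_def)
    moreover have "S = {} \<or> (\<exists>z. S = {z})"
      using S(2) T(2) card_le_full_sample(1)[of "{..<9}" S]
      by (metis One_nat_def card_0_eq card_1_singletonE finite_lessThan le_Suc_eq le_zero_eq)
    ultimately show ?thesis by auto
  qed
  then have "card {S. realizable cube_class {..<9} S \<and> card S \<le> 1} \<le>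
      card (insert {} ((\<lambda>z. {z}) ` ?P))"
    by (intro card_mono) auto
  also have "\<dots> \<le> Suc (card ((\<lambda>z. {z}) ` ?P))"
    by (rule card_insert_le_m1) auto
  also have "\<dots> \<le> Suc (card ?P)"
    by (simp add: card_image_le)
  also have "card ?P \<le> 13"
    by (rule order_trans[OF card_Un_le]) (simp add: card_cartesian_product)
  finally show ?thesis by simp
qed

text \<open>Two constant concepts realize all singletons: \<open>False\<close> is the cube concept
  of the empty set, \<open>True\<close> is the added one.\<close>

lemma realizable_singleton_cube_class_ext:
  assumes "x < 9"
  shows "realizable cube_class_ext {..<9} {(x, b)}"
proof -
  have "{(x, b)} \<subseteq> full_sample {..<9} (\<lambda>x\<in>{..<9}. b)"
    using assms by (auto simp: full_sample_def)
  moreover have "(\<lambda>x\<in>{..<9}. b) \<in> cube_class_ext"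
    by (cases b) (auto simp: cube_class_ext_def cube_class_def intro!: image_eqI[of _ _ "{}"])
  ultimately show ?thesis
    unfolding realizable_iff by blast
qed

text \<open>Distinct singletons are incomparable, and the 18 of them leave one to spare. The same
  family bounds both \<open>SMN'\<close> and \<open>AMN'\<close> of the extended class.\<close>

lemma small_antichain_cube_class_ext:
  obtains \<A> where "\<A> \<subseteq> {S. realizable cube_class_ext {..<9} S \<and> card S \<le> 1}"
    "antichain \<A>" "card \<A> = 17"
proof -
  let ?P = "(\<lambda>z. {z}) ` ({..<9::nat} \<times> (UNIV :: bool set))"
  have "card ?P = 18"
    by (subst card_image) (auto simp: card_cartesian_product inj_on_def)
  then obtain \<A> where \<A>: "\<A> \<subseteq> ?P" "card \<A> = 17"
    using obtain_subset_with_card_n[of 17 ?P] by auto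
  moreover have "antichain ?P"
    by (auto simp: antichain_def)
  moreover have "?P \<subseteq> {S. realizable cube_class_ext {..<9} S \<and> card S \<le> 1}"
    using realizable_singleton_cube_class_ext by auto
  ultimately show ?thesis
    using antichain_subset[of ?P \<A>] by (intro that[of \<A>]) auto
qed

lemma finite_small_realizable:
  "concept_class C X \<Longrightarrow> finite {S. realizable C X S \<and> card S \<le> d}"
  using finite_realizable by (rule finite_subset[rotated]) auto

lemma not_class_monotonic_SMN': "\<not> class_monotonic (SMN' :: nat parameter)"
proof -
  note ext = class_extension_cube_class
  then have C: "concept_class cube_class {..<9}" and C': "concept_class cube_class_ext {..<9}"
    by (auto simp: class_extension_def)
  let ?R = "\<lambda>d. {S. realizable cube_class {..<9} S \<and> card S \<le> d}"
  have "card cube_class \<le> card (?R (SMN' cube_class {..<9}))"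
    unfolding SMN'_def by (rule LeastI_ex) (use SMN'_exists[OF C] in blast)
  \<comment> \<open>The families grow with \<open>d\<close>, so the count for size 1 rules out size
    0 as well.\<close>
  moreover have "card (?R d) \<le> card (?R 1)" if "d \<le> 1" for d
    using that by (intro card_mono finite_small_realizable[OF C]) auto
  ultimately have "\<not> SMN' cube_class {..<9} \<le> 1"
    using card_cube_class card_small_realizable_cube_class by fastforce
  moreover have "SMN' cube_class_ext {..<9} \<le> 1"
    unfolding SMN'_def
  proof (rule Least_le)
    show "card cube_class_ext \<le> card {S. realizable cube_class_ext {..<9} S \<and> card S \<le> 1}"
      using small_antichain_cube_class_ext card_cube_class_ext
      by (metis card_mono finite_small_realizable[OF C'])
  qed
  ultimately have "\<not> SMN' cube_class {..<9} \<le> SMN' cube_class_ext {..<9}"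
    by linarith
  with ext show ?thesis
    unfolding class_monotonic_def by blast
qed

text \<open>An antichain of 16 samples is in particular 16 samples, so the count that refutes
  \<open>SMN'\<close> applies again.\<close>

lemma not_class_monotonic_AMN': "\<not> class_monotonic (AMN' :: nat parameter)"
proof -
  note ext = class_extension_cube_class
  then have C: "concept_class cube_class {..<9}"
    by (auto simp: class_extension_def)
  let ?R = "\<lambda>d. {S. realizable cube_class {..<9} S \<and> card S \<le> d}"
  have "\<exists>\<A> \<subseteq> ?R (AMN' cube_class {..<9}). antichain \<A> \<and> card \<A> = card cube_class"
    unfolding AMN'_def by (rule LeastI_ex) (use AMN'_exists[OF C] in blast)
  then have "card cube_class \<le> card (?R (AMN' cube_class {..<9}))"
    by (metis card_mono finite_small_realizable[OF C])
  moreover have "card (?R d) \<le> card (?R 1)" if "d \<le> 1" for d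
    using that by (intro card_mono finite_small_realizable[OF C]) auto
  ultimately have "\<not> AMN' cube_class {..<9} \<le> 1"
    using card_cube_class card_small_realizable_cube_class by fastforce
  moreover have "AMN' cube_class_ext {..<9} \<le> 1"
    unfolding AMN'_def
    by (rule Least_le) (use small_antichain_cube_class_ext card_cube_class_ext in metis)
  ultimately have "\<not> AMN' cube_class {..<9} \<le> AMN' cube_class_ext {..<9}"
    by linarith
  with ext show ?thesis
    unfolding class_monotonic_def by blast
qed

section \<open>Failure of domain monotonicity\<close>

text \<open>
  Warmuth's class consists of ten concepts on five points, has VC-dimension 2 and recursive teaching
  dimension 3.  Bits 0 to 4 of the codes below list its concepts; bit 5 is the label of a sixth point,
  chosen such that three points become shattered while every concept keeps teaching dimension 3.
\<close>

definition warmuth_codes :: "nat list" where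
  "warmuth_codes = [3, 38, 44, 56, 49, 43, 22, 13, 26, 21]"

text \<open>For \<open>k = 5\<close> these are the indicator functions of the cyclic shifts modulo 5
  of the sets {0, 1} and {0, 1, 3}.\<close>

definition warmuth_class :: "nat \<Rightarrow> (nat \<Rightarrow> bool) set" where
  "warmuth_class k = (\<lambda>m. \<lambda>x\<in>{..<k}. bit m x) ` set warmuth_codes"

text \<open>Five bits already separate the codes, so forgetting the sixth point loses no concept.
  Like the facts below, this is phrased with quantifiers over explicit finite sets, which evaluation
  can decide.\<close>

lemma warmuth_codes_distinguished:
  "\<forall>m\<in>set warmuth_codes. \<forall>n\<in>set warmuth_codes.
    (\<forall>x\<in>set [0..<5]. bit m x = bit n x) \<longrightarrow> m = n"
  by code_simp

text \<open>A constant pattern always fails. Three cyclically consecutive points lie in no concept;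
  any other triple has two non-adjacent points as its complement, which contain no concept.\<close>

lemma warmuth_codes_not_shattered:
  "\<forall>p\<in>set [0..<5]. \<forall>q\<in>set [0..<5]. \<forall>r\<in>set [0..<5]. distinct [p, q, r] \<longrightarrow>
    (\<exists>y\<in>{False, True}. \<forall>n\<in>set warmuth_codes. (bit n p, bit n q, bit n r) \<noteq> (y, y, y))"
  by code_simp

text \<open>Points 0 and 3 show all four patterns, and the added bit takes both values on each of
  them.\<close>

lemma warmuth_codes_shattered:
  "\<forall>x\<in>{False, True}. \<forall>y\<in>{False, True}. \<forall>z\<in>{False, True}.
    \<exists>n\<in>set warmuth_codes. (bit n 0, bit n 3, bit n 5) = (x, y, z)"
  by code_simp

text \<open>The points \<open>p\<close> and \<open>q\<close> may coincide, so samples of size below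
  2 are covered as well.\<close>

lemma warmuth_codes_not_taught_by_two:
  "\<forall>m\<in>set warmuth_codes. \<forall>p\<in>set [0..<6]. \<forall>q\<in>set [0..<6].
    \<exists>n\<in>set warmuth_codes. n \<noteq> m \<and> bit n p = bit m p \<and> bit n q = bit m q"
  by code_simp

lemma inj_on_warmuth:
  assumes "5 \<le> k"
  shows "inj_on (\<lambda>m. \<lambda>x\<in>{..<k}. bit m x) (set warmuth_codes)"
proof (rule inj_onI)
  fix m n
  assume mn: "m \<in> set warmuth_codes" "n \<in> set warmuth_codes"
    and eq: "(\<lambda>x\<in>{..<k}. bit m x) = (\<lambda>x\<in>{..<k}. bit n x)"
  have "bit m x = bit n x" if "x \<in> set [0..<5]" for x
    using fun_cong[OF eq, of x] that assms by auto
  with mn warmuth_codes_distinguished show "m = n" by blast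
qed

lemma concept_class_warmuth_class: "concept_class (warmuth_class k) {..<k}"
  by (auto simp: concept_class_def warmuth_class_def warmuth_codes_def)

lemma domain_extension_warmuth_class:
  "domain_extension (warmuth_class 6) {..<6} (warmuth_class 5) {..<5}"
proof -
  have "warmuth_class 5 = (\<lambda>c. restrict c {..<5}) ` warmuth_class 6"
    by (simp add: warmuth_class_def image_image restrict_restrict Int_absorb1)
  moreover have "card (warmuth_class k) = card (set warmuth_codes)" if "5 \<le> k" for k
    unfolding warmuth_class_def using inj_on_warmuth[OF that] by (rule card_image)
  then have "card (warmuth_class 5) = card (warmuth_class 6)"
    by simp
  moreover have "{..<5::nat} \<subset> {..<6}"
    by (auto intro!: psubsetI)
  ultimately show ?thesis
    unfolding domain_extension_def using concept_class_warmuth_class by blast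
qed

lemma VCD_warmuth_class_5: "VCD (warmuth_class 5) {..<5} \<le> 2"
proof (rule ccontr)
  assume "\<not> ?thesis"
  then obtain A where A: "shattered (warmuth_class 5) {..<5} A" "3 \<le> card A"
    by (metis concept_class_warmuth_class VCD_attained not_less_eq_eq numeral_2_eq_2 numeral_3_eq_3)
  obtain B where "B \<subseteq> A" "card B = 3"
    using A(2) obtain_subset_with_card_n by blast
  then obtain p q r where pqr: "B = {p, q, r}" "distinct [p, q, r]"
    by (auto simp: card_3_iff)
  with \<open>B \<subseteq> A\<close> A(1) have "{p, q, r} \<subseteq> {..<5}" "{p, q, r} \<subseteq> A"
    by (auto simp: shattered_iff)
  then have "p \<in> set [0..<5]" "q \<in> set [0..<5]" "r \<in> set [0..<5]"
    by auto
  with pqr(2) obtain y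
    where none: "\<forall>n\<in>set warmuth_codes. (bit n p, bit n q, bit n r) \<noteq> (y, y, y)"
    using warmuth_codes_not_shattered by blast
  have "\<forall>b. \<exists>c\<in>warmuth_class 5. \<forall>u\<in>A. c u = b u"
    using A(1) unfolding shattered_iff by (rule conjunct2)
  \<comment> \<open>Because the refuting pattern is constant, it can be demanded on all of
    \<open>A\<close> at once, with no extension of a labelling from three points.\<close>
  from spec[OF this, of "\<lambda>_. y"] obtain c where c: "c \<in> warmuth_class 5" "\<forall>u\<in>A. c u = y"
    by blast
  then obtain n where n: "n \<in> set warmuth_codes" "c = (\<lambda>u\<in>{..<5}. bit n u)"
    by (auto simp: warmuth_class_def)
  have "(bit n p, bit n q, bit n r) = (c p, c q, c r)"
    using \<open>{p, q, r} \<subseteq> {..<5}\<close> n(2) by simp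
  also have "\<dots> = (y, y, y)"
    using c(2) \<open>{p, q, r} \<subseteq> A\<close> by auto
  finally show False
    using none n(1) by blast
qed

lemma VCD_warmuth_class_6: "3 \<le> VCD (warmuth_class 6) {..<6}"
proof -
  have "shattered (warmuth_class 6) {..<6} {0, 3, 5}"
    unfolding shattered_iff
  proof (intro conjI allI)
    fix b :: "nat \<Rightarrow> bool"
    obtain n where n: "n \<in> set warmuth_codes" "(bit n 0, bit n 3, bit n 5) = (b 0, b 3, b 5)"
      using warmuth_codes_shattered by (metis (full_types) insertCI)
    then show "\<exists>c\<in>warmuth_class 6. \<forall>x\<in>{0, 3, 5}. c x = b x"
      by (intro bexI[of _ "\<lambda>x\<in>{..<6}. bit n x"]) (auto simp: warmuth_class_def)
  qed auto
  then show ?thesis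
    using card_le_VCD[OF concept_class_warmuth_class] by fastforce
qed

text \<open>The class itself is the subclass that witnesses the bound, since none of its concepts
  can be taught by two examples.\<close>

lemma RTD_warmuth_class_6: "3 \<le> RTD (warmuth_class 6) {..<6}"
proof -
  let ?C = "warmuth_class 6"
  note C = concept_class_warmuth_class[of 6]
  have "3 \<le> TD c ?C {..<6}" if c: "c \<in> ?C" for c
  proof (rule ccontr)
    assume "\<not> ?thesis"
    moreover obtain S where S: "labeled_sample {..<6} S" "card S = TD c ?C {..<6}"
      "{c'\<in>?C. consistent c' S} = {c}"
      using TD_attained[OF C subset_refl c] .
    ultimately have "card S \<le> 2" by simp
    have "S \<subseteq> full_sample {..<6} c"
      using S sample_iff[of "{..<6}" S c] by blast
    have "finite (fst ` S)" "card (fst ` S) \<le> 2" "fst ` S \<subseteq> {..<6}"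
      using \<open>card S \<le> 2\<close> card_image_le[of S fst] S(1)
        card_le_full_sample(1)[OF _ \<open>S \<subseteq> full_sample {..<6} c\<close>]
      by (auto simp: labeled_sample_def)
    \<comment> \<open>The points of \<open>S\<close> are padded to exactly two, so that
      \<open>p\<close> and \<open>q\<close> exist even when \<open>S\<close> is smaller.\<close>
    then obtain P where "fst ` S \<subseteq> P" "P \<subseteq> {..<6}" "card P = 2"
      using exists_subset_between[of "fst ` S" 2 "{..<6}"] by auto
    then obtain p q where pq: "p < 6" "q < 6" "fst ` S \<subseteq> {p, q}"
      by (auto simp: card_2_iff)
    obtain m where m: "m \<in> set warmuth_codes" "c = (\<lambda>x\<in>{..<6}. bit m x)"
      using c by (auto simp: warmuth_class_def)
    have "p \<in> set [0..<6]" "q \<in> set [0..<6]"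
      using pq by auto
    then obtain n where n: "n \<in> set warmuth_codes" "n \<noteq> m" "bit n p = bit m p" "bit n q = bit m q"
      using m(1) warmuth_codes_not_taught_by_two by blast
    let ?c' = "\<lambda>x\<in>{..<6}. bit n x"
    have "consistent ?c' S"
      unfolding consistent_def
    proof clarify
      fix x b assume "(x, b) \<in> S"
      then have "x \<in> {p, q}" "c x = b"
        using pq(3) \<open>S \<subseteq> full_sample {..<6} c\<close> by (force simp: full_sample_def)+
      then show "?c' x = b"
        using n m(2) pq by auto
    qed
    moreover have "?c' \<in> ?C"
      using n(1) by (auto simp: warmuth_class_def)
    ultimately have "?c' = c"
      using S(3) by blast
    then have "n = m"
      using inj_onD[OF inj_on_warmuth[of 6]] n(1) m by simp
    with n(2) show False ..
  qed
  then have "3 \<le> Min ((\<lambda>c. TD c ?C {..<6}) ` ?C)"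
    using C concept_class_finite[OF C] by (auto simp: concept_class_def)
  also have "\<dots> \<le> RTD ?C {..<6}"
    using C by (intro RTD_ge) (auto simp: concept_class_def)
  finally show ?thesis .
qed

lemma not_domain_monotonic_VCD: "\<not> domain_monotonic (VCD :: nat parameter)"
  using domain_extension_warmuth_class VCD_warmuth_class_5 VCD_warmuth_class_6
  unfolding domain_monotonic_def by fastforce

lemma not_domain_monotonic_min_VCD_RTD: "\<not> domain_monotonic (min_VCD_RTD :: nat parameter)"
proof -
  have "min_VCD_RTD (warmuth_class 5) {..<5} < min_VCD_RTD (warmuth_class 6) {..<6}"
    using VCD_warmuth_class_5 VCD_warmuth_class_6 RTD_warmuth_class_6
    by (simp add: min_VCD_RTD_def min_def)
  then show ?thesis
    using domain_extension_warmuth_class unfolding domain_monotonic_def by (meson not_less)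
qed

theorem theorem5p1:
  "(class_monotonic (VCD :: 'a parameter) \<and>
    class_monotonic (RTD :: 'a parameter) \<and>
    class_monotonic (min_VCD_RTD :: 'a parameter) \<and>
    class_monotonic (STD_min :: 'a parameter) \<and>
    class_monotonic (AMN :: 'a parameter) \<and>
    class_monotonic (GMN' :: 'a parameter) \<and>
    class_monotonic (GMN :: 'a parameter) \<and>
    class_monotonic (SMN :: 'a parameter) \<and>
    \<not> class_monotonic (AMN' :: nat parameter) \<and>
    \<not> class_monotonic (SMN' :: nat parameter))
   \<and>
   (domain_monotonic (RTD :: 'a parameter) \<and>
    domain_monotonic (STD_min :: 'a parameter) \<and>
    domain_monotonic (AMN :: 'a parameter) \<and>
    domain_monotonic (AMN' :: 'a parameter) \<and>
    domain_monotonic (GMN' :: 'a parameter) \<and>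
    domain_monotonic (GMN :: 'a parameter) \<and>
    domain_monotonic (SMN :: 'a parameter) \<and>
    domain_monotonic (SMN' :: 'a parameter) \<and>
    \<not> domain_monotonic (VCD :: nat parameter) \<and>
    \<not> domain_monotonic (min_VCD_RTD :: nat parameter) \<and>
    (\<forall>(C :: ('a \<Rightarrow> bool) set) X C' X'.
       domain_extension C' X' C X \<longrightarrow> VCD C X \<le> VCD C' X'))"
  using VCD_class_monotonic RTD_class_monotonic min_VCD_RTD_class_monotonic
    STD_min_class_monotonic AMN_class_monotonic GMN'_class_monotonic GMN_class_monotonic
    SMN_class_monotonic not_class_monotonic_AMN' not_class_monotonic_SMN'
    RTD_domain_monotonic STD_min_domain_monotonic AMN_domain_monotonic AMN'_domain_monotonic
    GMN'_domain_monotonic GMN_domain_monotonic SMN_domain_monotonic SMN'_domain_monotonic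
    not_domain_monotonic_VCD not_domain_monotonic_min_VCD_RTD VCD_domain_extension_le
  by blast

end
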